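(* The class $k\mathrm{STAT}$ consists exactly of the functions $f:\{0,1\}^n\to\{0,1\}$ for which there exist linear forms $L_1,\dots,L_p$ with $p=\mathrm{poly}(n)$, a positive integer $k$, and a labelling function $\mathrm{lab}:\{1,\dots,p\}\to\{0,1\}$ such that for all $\mathbf{x}$, \[ f(\mathbf{x})=1\iff (L_1(\mathbf{x}),\dots,L_p(\mathbf{x}))_{(k)}=L_i(\mathbf{x})\text{ for some } i \text{ with } \mathrm{lab}(i)=1. \] The class $k\mathrm{STAT}_{\mathrm{poly}}$ consists exactly of the functions with the same representation in which the linear forms have coefficients bounded by a polynomial in $n$.
   Context: Linear forms are affine functions of $\mathbf{x}$ (with integer coefficients, without loss of generality). For a vector $\mathbf{z}$, $\mathbf{z}_{(k)}$ denotes its $k$-th smallest entry. $k\mathrm{STAT}$ is the class of (families of) functions $f:\{0,1\}^n\to\{0,1\}$ for which there exist linear forms with integer coefficients $L_1,\dots,L_{\ell_1},R_1,\dots,R_{\ell_2}$ with $\ell_1+\ell_2$ polynomial in $n$, and integers $k_l,k_r$, such that $f(\mathbf{x})=1\iff(L_1(\mathbf{x}),\dots,L_{\ell_1}(\mathbf{x}))_{(k_l)}<(R_1(\mathbf{x}),\dots,R_{\ell_2}(\mathbf{x}))_{(k_r)}$. $k\mathrm{STAT}_{\mathrm{poly}}$ is the subclass where all coefficients are bounded in absolute value by a polynomial in $n$. *)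

theory Defs
  imports "HOL-Computational_Algebra.Polynomial"
begin

text \<open>
  A family $(f_n)$ of Boolean functions $f_n : \{0,1\}^n \to \{0,1\}$ is a single function on
  lists of bits; $f_n$ is its restriction to the lists of length $n$.
\<close>

type_synonym bool_family = "bool list \<Rightarrow> bool"

text \<open>The constant term, followed by one coefficient for each variable.\<close>

type_synonym linear_form = "int \<times> int list"

definition linear_form :: "nat \<Rightarrow> linear_form \<Rightarrow> bool" where
  "linear_form n L \<longleftrightarrow> length (snd L) = n"

definition eval_form :: "linear_form \<Rightarrow> bool list \<Rightarrow> int" where
  "eval_form L x = fst L + (\<Sum>i<length x. snd L ! i * of_bool (x ! i))"

text \<open>The constant term counts as a coefficient.\<close>

definition coeffs_bounded :: "nat \<Rightarrow> linear_form \<Rightarrow> bool" where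
  "coeffs_bounded B L \<longleftrightarrow> (\<forall>c \<in> insert (fst L) (set (snd L)). \<bar>c\<bar> \<le> int B)"

text \<open>Ranks start at 1; meaningful only for \<open>1 \<le> k \<le> length zs\<close>.\<close>

definition kth_smallest :: "nat \<Rightarrow> int list \<Rightarrow> int" where
  "kth_smallest k zs = sort zs ! (k - 1)"

definition kstat_rep ::
    "nat \<Rightarrow> bool_family \<Rightarrow> linear_form list \<Rightarrow> linear_form list \<Rightarrow> nat \<Rightarrow> nat \<Rightarrow> bool" where
  "kstat_rep n f Ls Rs kl kr \<longleftrightarrow>
     (\<forall>L \<in> set Ls \<union> set Rs. linear_form n L) \<and>
     1 \<le> kl \<and> kl \<le> length Ls \<and> 1 \<le> kr \<and> kr \<le> length Rs \<and>
     (\<forall>x. length x = n \<longrightarrow>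
        (f x \<longleftrightarrow> kth_smallest kl (map (\<lambda>L. eval_form L x) Ls)
                  < kth_smallest kr (map (\<lambda>R. eval_form R x) Rs)))"

definition kSTAT :: "bool_family set" where
  "kSTAT = {f. \<exists>s :: nat poly. \<forall>n. \<exists>Ls Rs kl kr.
     length Ls + length Rs \<le> poly s n \<and> kstat_rep n f Ls Rs kl kr}"

definition kSTAT_poly :: "bool_family set" where
  "kSTAT_poly = {f. \<exists>s t :: nat poly. \<forall>n. \<exists>Ls Rs kl kr.
     length Ls + length Rs \<le> poly s n \<and> kstat_rep n f Ls Rs kl kr \<and>
     (\<forall>L \<in> set Ls \<union> set Rs. coeffs_bounded (poly t n) L)}"

text \<open>Several forms may attain the $k$-th smallest value; one of them with label 1 suffices.\<close>

definition labelled_rep ::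
    "nat \<Rightarrow> bool_family \<Rightarrow> linear_form list \<Rightarrow> nat \<Rightarrow> (nat \<Rightarrow> bool) \<Rightarrow> bool" where
  "labelled_rep n f Ls k lab \<longleftrightarrow>
     (\<forall>L \<in> set Ls. linear_form n L) \<and> 1 \<le> k \<and> k \<le> length Ls \<and>
     (\<forall>x. length x = n \<longrightarrow>
        (f x \<longleftrightarrow> (\<exists>i < length Ls. lab i \<and>
           kth_smallest k (map (\<lambda>L. eval_form L x) Ls) = eval_form (Ls ! i) x)))"

end

theory Submission
  imports Defs
begin

text \<open>
  From two order statistics to a labelled one: break all ties, the right-hand entries first. The
  comparison is decided by the number \<open>v\<close> of right-hand entries among the \<open>kl + kr - 1\<close> smallest
  entries of the merged list. The label must reveal \<open>v\<close>, so each left-hand entry is repeated \<open>p\<close>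
  times and each right-hand entry \<open>p + 1\<close> times, with increasing offsets: the entry of rank
  \<open>p * (kl + kr)\<close> is then the copy number \<open>p - 1 - v\<close> of its original.

  Conversely, several labelled and unlabelled forms may attain the $k$-th smallest value. Repeat
  each form \<open>p + 1\<close> times, the unlabelled ones with offsets \<open>1, \<dots>, p + 1\<close>. One list gives all copies of
  labelled forms the offset \<open>0\<close>, the other one the offset \<open>p + 1\<close>. The order statistics of rank
  \<open>(p + 1) * (k - 1) + 1\<close> agree if no labelled form attains the value, and otherwise the first one
  is strictly smaller.
\<close>

section \<open>Order statistics by counting\<close>

text \<open>In the sorted list the positions satisfying \<open>P\<close> form an initial segment, so
  \<open>P\<close> holds at position \<open>k - 1\<close> exactly if this segment has at least
  \<open>k\<close> elements.\<close>

lemma antimono_kth_smallest_iff: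
  assumes P: "\<And>x y. x \<le> y \<Longrightarrow> P y \<Longrightarrow> P x" and k: "1 \<le> k" "k \<le> length zs"
  shows "P (kth_smallest k zs) \<longleftrightarrow> k \<le> length (filter P zs)"
proof -
  define s where "s = sort zs"
  have len: "length s = length zs" and sorted: "sorted s"
    by (simp_all add: s_def)
  have "length (filter P zs) = length (filter P s)"
    by (simp add: s_def filter_sort)
  then have card: "length (filter P zs) = card {i. i < length s \<and> P (s ! i)}"
    by (simp add: length_filter_conv_card)
  show ?thesis
  proof (cases "P (s ! (k - 1))")
    case True
    have "{..<k} \<subseteq> {i. i < length s \<and> P (s ! i)}"
    proof
      fix i assume "i \<in> {..<k}"
      then have "s ! i \<le> s ! (k - 1)"
        using sorted k len by (intro sorted_nth_mono) auto
      then show "i \<in> {i. i < length s \<and> P (s ! i)}"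
        using P True k len \<open>i \<in> {..<k}\<close> by auto
    qed
    then have "k \<le> card {i. i < length s \<and> P (s ! i)}"
      using card_mono[of "{i. i < length s \<and> P (s ! i)}" "{..<k}"] by simp
    then show ?thesis
      using True card by (simp add: kth_smallest_def s_def)
  next
    case False
    have "{i. i < length s \<and> P (s ! i)} \<subseteq> {..<k - 1}"
    proof
      fix i assume i: "i \<in> {i. i < length s \<and> P (s ! i)}"
      have "\<not> k - 1 \<le> i"
        using sorted_nth_mono[OF sorted, of "k - 1" i] P False i by auto
      then show "i \<in> {..<k - 1}" by simp
    qed
    then have "card {i. i < length s \<and> P (s ! i)} \<le> k - 1"
      using card_mono[of "{..<k - 1}"] by force
    then show ?thesis
      using False card k by (simp add: kth_smallest_def s_def)
  qed
qed

lemma kth_smallest_le_iff: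
  assumes "distinct W" "1 \<le> k" "k \<le> length W"
  shows "kth_smallest k (map g W) \<le> t \<longleftrightarrow> k \<le> card {w \<in> set W. g w \<le> t}"
  using antimono_kth_smallest_iff[of "\<lambda>z. z \<le> t" k "map g W"] assms
  by (simp add: filter_map distinct_length_filter comp_def Int_def conj_commute)

lemma kth_smallest_less_iff:
  assumes "distinct W" "1 \<le> k" "k \<le> length W"
  shows "kth_smallest k (map g W) < t \<longleftrightarrow> k \<le> card {w \<in> set W. g w < t}"
  using kth_smallest_le_iff[OF assms, of g "t - 1"] by simp

text \<open>Copies are indexed by pairs (original, copy number); this counts them one original at a
  time.\<close>

lemma card_Sigma_filter:
  assumes "finite A" "\<And>i. i \<in> A \<Longrightarrow> finite (B i)"
  shows "card {w \<in> Sigma A B. P w} = (\<Sum>i\<in>A. card {j \<in> B i. P (i, j)})"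
proof -
  have "{w \<in> Sigma A B. P w} = (SIGMA i:A. {j \<in> B i. P (i, j)})"
    by auto
  then show ?thesis
    using assms by (simp add: card_SigmaI)
qed

section \<open>Lexicographic comparison by scaling\<close>

text \<open>The offsets act as last digits in base \<open>c\<close>, so they decide the comparison
  only between equal leading parts.\<close>

lemma scaled_less_iff:
  fixes a b c :: int
  assumes "0 \<le> i" "i < c" "0 \<le> j" "j < c"
  shows "c * a + i < c * b + j \<longleftrightarrow> a < b \<or> (a = b \<and> i < j)"
proof -
  have *: "c * a + i < c * b + j" if "a < b" "0 \<le> j" "i < c" for a b i j :: int
  proof -
    have "c * (a + 1) \<le> c * b"
      using that assms by (intro mult_left_mono) auto
    then show ?thesis using that by (simp add: algebra_simps)
  qed
  show ?thesis
    using *[of a b j i] *[of b a i j] assms by (cases a b rule: linorder_cases) auto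
qed

lemma scaled_eq_iff:
  fixes a b c :: int
  assumes "0 \<le> i" "i < c" "0 \<le> j" "j < c"
  shows "c * a + i = c * b + j \<longleftrightarrow> a = b \<and> i = j"
  using scaled_less_iff[OF assms, of a b] scaled_less_iff[of j c i b a] assms by auto

section \<open>Scaled and shifted linear forms\<close>

definition scale_shift :: "int \<Rightarrow> int \<Rightarrow> linear_form \<Rightarrow> linear_form" where
  "scale_shift c d L = (c * fst L + d, map ((*) c) (snd L))"

lemma linear_form_scale_shift [simp]: "linear_form n (scale_shift c d L) = linear_form n L"
  by (simp add: linear_form_def scale_shift_def)

lemma eval_form_scale_shift:
  assumes "linear_form (length x) L"
  shows "eval_form (scale_shift c d L) x = c * eval_form L x + d"
proof -
  have "(\<Sum>i<length x. map ((*) c) (snd L) ! i * of_bool (x ! i)) =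
      (\<Sum>i<length x. c * (snd L ! i * of_bool (x ! i)))"
    using assms by (intro sum.cong) (auto simp: linear_form_def)
  then show ?thesis
    by (simp only: eval_form_def scale_shift_def fst_conv snd_conv distrib_left sum_distrib_left)
qed

lemma coeffs_bounded_mono: "coeffs_bounded B L \<Longrightarrow> B \<le> B' \<Longrightarrow> coeffs_bounded B' L"
  unfolding coeffs_bounded_def by fastforce

text \<open>A single \<open>C\<close> bounds both the factor and the shift, which gives
  \<open>C * B + C\<close> for the constant term.\<close>

lemma coeffs_bounded_scale_shift:
  assumes L: "coeffs_bounded B L" and c: "\<bar>c\<bar> \<le> int C" and d: "\<bar>d\<bar> \<le> int C"
  shows "coeffs_bounded (C * (B + 1)) (scale_shift c d L)"
proof -
  have *: "\<bar>c * a\<bar> \<le> int (C * B)" if "a \<in> insert (fst L) (set (snd L))" for a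
    using that L c unfolding coeffs_bounded_def abs_mult of_nat_mult by (intro mult_mono) auto
  have "\<bar>c * fst L + d\<bar> \<le> int (C * B) + int C"
    using *[of "fst L"] d by (intro order_trans[OF abs_triangle_ineq] add_mono) auto
  moreover have "\<bar>c * a\<bar> \<le> int (C * B) + int C" if "a \<in> set (snd L)" for a
    using *[of a] that by simp
  ultimately show ?thesis
    by (auto simp: coeffs_bounded_def scale_shift_def algebra_simps)
qed

section \<open>From two order statistics to a labelled one\<close>

text \<open>The entries with index below \<open>r\<close> are those of the right-hand list; they come first so that
  \<open>tie_broken\<close> places them before the entries of the left-hand list of the same value.\<close>

definition tie_broken :: "(nat \<Rightarrow> int) \<Rightarrow> nat \<Rightarrow> nat \<Rightarrow> int" where
  "tie_broken val p i = int p * val i + int i"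

text \<open>Copy numbers are at most \<open>p\<close>, so the factor \<open>p + 1\<close> keeps the
  copies of each entry in a block of their own.\<close>

definition copy :: "(nat \<Rightarrow> int) \<Rightarrow> nat \<Rightarrow> nat \<times> nat \<Rightarrow> int" where
  "copy val p = (\<lambda>(i, j). int (p + 1) * tie_broken val p i + int j)"

context
  fixes val :: "nat \<Rightarrow> int" and p r kl kr :: nat and W :: "(nat \<times> nat) list"
  assumes r: "r \<le> p" and kl: "1 \<le> kl" "kl \<le> p - r" and kr: "1 \<le> kr" "kr \<le> r"
    and W: "distinct W" "set W = (SIGMA i:{..<p}. {..<if i < r then p + 1 else p})"
begin

lemma tie_broken_less_iff:
  assumes "i < p" "e < p"
  shows "tie_broken val p i < tie_broken val p e \<longleftrightarrow> val i < val e \<or> val i = val e \<and> i < e"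
  unfolding tie_broken_def using assms by (subst scaled_less_iff) auto

lemma tie_broken_eq_iff:
  assumes "i < p" "e < p"
  shows "tie_broken val p i = tie_broken val p e \<longleftrightarrow> i = e"
  unfolding tie_broken_def using assms by (subst scaled_eq_iff) auto

lemma card_split:
  "card {i \<in> {..<p}. P i} = card {i \<in> {r..<p}. P i} + card {i \<in> {..<r}. P i}"
proof -
  have "{i \<in> {..<p}. P i} = {i \<in> {r..<p}. P i} \<union> {i \<in> {..<r}. P i}"
    using r by auto
  also have "card \<dots> = card {i \<in> {r..<p}. P i} + card {i \<in> {..<r}. P i}"
    by (rule card_Un_disjoint) auto
  finally show ?thesis .
qed

text \<open>Since the entries from the right-hand list have one copy more, the number of copies below
  those of \<open>e\<close> reveals how many entries of the right-hand list precede \<open>e\<close>.\<close>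

lemma card_copies_less:
  assumes e: "e < p" and j: "j \<le> p"
  shows "card {w \<in> set W. copy val p w < int (p + 1) * tie_broken val p e + int j} =
    p * card {i \<in> {..<p}. tie_broken val p i < tie_broken val p e} +
    card {i \<in> {..<r}. tie_broken val p i < tie_broken val p e} + j"
proof -
  let ?b = "\<lambda>i. tie_broken val p i < tie_broken val p e"
  have "card {j' \<in> {..<if i < r then p + 1 else p}.
           copy val p (i, j') < int (p + 1) * tie_broken val p e + int j} =
        (if ?b i then p else 0) + (if i < r \<and> ?b i then 1 else 0) + (if i = e then j else 0)"
    if i: "i < p" for i
  proof -
    have less: "copy val p (i, j') < int (p + 1) * tie_broken val p e + int j \<longleftrightarrow>
        ?b i \<or> i = e \<and> j' < j" if "j' < p + 1" for j'
      unfolding copy_def prod.case using that j tie_broken_eq_iff[OF i e]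
      by (subst scaled_less_iff) auto
    show ?thesis
    proof (cases "?b i")
      case True
      then have "{j' \<in> {..<if i < r then p + 1 else p}.
           copy val p (i, j') < int (p + 1) * tie_broken val p e + int j} = {..<if i < r then p + 1 else p}"
        using less by (auto split: if_splits)
      then show ?thesis using True by auto
    next
      case False
      then have "{j' \<in> {..<if i < r then p + 1 else p}.
           copy val p (i, j') < int (p + 1) * tie_broken val p e + int j} = (if i = e then {..<j} else {})"
        using less j by (auto split: if_splits)
      then show ?thesis using False by auto
    qed
  qed
  then have "card {w \<in> set W. copy val p w < int (p + 1) * tie_broken val p e + int j} =
     (\<Sum>i<p. (if ?b i then p else 0) + (if i < r \<and> ?b i then 1 else 0) + (if i = e then j else 0))"
    unfolding W(2) by (subst card_Sigma_filter) (auto intro!: sum.cong)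
  also have "\<dots> = p * card {i \<in> {..<p}. ?b i} + card {i \<in> {..<p}. i < r \<and> ?b i} + j"
    using e by (simp add: sum.distrib flip: sum.inter_filter)
  also have "{i \<in> {..<p}. i < r \<and> ?b i} = {i \<in> {..<r}. ?b i}"
    using r by auto
  finally show ?thesis .
qed

text \<open>If \<open>u\<close> left-hand and \<open>v\<close> right-hand entries precede
  \<open>e\<close>, then \<open>u + v = kl + kr - 1\<close>, so exactly one of
  \<open>kl \<le> u\<close> and \<open>kr \<le> v\<close> holds. The side that reaches its rank has
  its order statistic at most \<open>val e\<close>, the other side at least \<open>val e\<close>.
  The order of ties yields strictness when it is the left-hand side.\<close>

lemma order_statistics_less_iff:
  assumes e: "e < p"
    and rank: "card {i \<in> {..<p}. tie_broken val p i < tie_broken val p e} = kl + kr - 1"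
  shows "kth_smallest kl (map val [r..<p]) < kth_smallest kr (map val [0..<r]) \<longleftrightarrow>
    card {i \<in> {..<r}. tie_broken val p i < tie_broken val p e} < kr"
proof -
  define u where "u = card {i \<in> {r..<p}. tie_broken val p i < tie_broken val p e}"
  define v where "v = card {i \<in> {..<r}. tie_broken val p i < tie_broken val p e}"
  have uv: "u + v = kl + kr - 1"
    using rank card_split by (simp add: u_def v_def)
  have L_le: "kth_smallest kl (map val [r..<p]) \<le> t \<longleftrightarrow> kl \<le> card {i \<in> {r..<p}. val i \<le> t}"
    and L_less: "kth_smallest kl (map val [r..<p]) < t \<longleftrightarrow> kl \<le> card {i \<in> {r..<p}. val i < t}"
    and R_le: "kth_smallest kr (map val [0..<r]) \<le> t \<longleftrightarrow> kr \<le> card {i \<in> {..<r}. val i \<le> t}"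
    and R_less: "kth_smallest kr (map val [0..<r]) < t \<longleftrightarrow> kr \<le> card {i \<in> {..<r}. val i < t}"
    for t
    using kl kr by (simp_all add: kth_smallest_le_iff kth_smallest_less_iff atLeast0LessThan)
  have mono: "card {i \<in> A. P i} \<le> card {i \<in> A. Q i}"
    if "finite A" "\<And>i. i \<in> A \<Longrightarrow> P i \<Longrightarrow> Q i" for A :: "nat set" and P Q
    using that by (intro card_mono) auto
  have u_ge: "card {i \<in> {r..<p}. val i < val e} \<le> u"
    unfolding u_def using e by (intro mono) (auto simp: tie_broken_less_iff)
  have u_le: "u \<le> card {i \<in> {r..<p}. val i \<le> val e}"
    unfolding u_def using e by (intro mono) (auto simp: tie_broken_less_iff)
  have v_ge: "card {i \<in> {..<r}. val i < val e} \<le> v"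
    unfolding v_def using e r by (intro mono) (auto simp: tie_broken_less_iff)
  have v_le: "v \<le> card {i \<in> {..<r}. val i \<le> val e}"
    unfolding v_def using e r by (intro mono) (auto simp: tie_broken_less_iff)
  show ?thesis
  proof (cases "v < kr")
    case False
    then have "u < kl" using uv kl by linarith
    then have "\<not> kth_smallest kl (map val [r..<p]) < val e"
      using L_less u_ge by auto
    moreover have "kth_smallest kr (map val [0..<r]) \<le> val e"
      using R_le v_le False by auto
    ultimately show ?thesis using False by (auto simp: v_def)
  next
    case True
    then have u: "kl \<le> u" using uv by linarith
    have "kth_smallest kl (map val [r..<p]) < kth_smallest kr (map val [0..<r])"
    proof (cases "e < r")
      \<comment> \<open>Left-hand entries of value \<open>val e\<close> come after \<open>e\<close>,
        so all \<open>u\<close> preceding ones are strictly smaller in value.\<close>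
      case e_right: True
      have "u \<le> card {i \<in> {r..<p}. val i < val e}"
        unfolding u_def using e e_right by (intro mono) (auto simp: tie_broken_less_iff)
      then have "kth_smallest kl (map val [r..<p]) < val e"
        using L_less u by auto
      moreover have "\<not> kth_smallest kr (map val [0..<r]) < val e"
        using R_less v_ge True by auto
      ultimately show ?thesis by linarith
    next
      \<comment> \<open>Right-hand entries of value \<open>val e\<close> come before
        \<open>e\<close>, so \<open>v\<close> already counts all right-hand values up to
        \<open>val e\<close>.\<close>
      case e_left: False
      have "card {i \<in> {..<r}. val i \<le> val e} \<le> v"
        unfolding v_def using e e_left r by (intro mono) (auto simp: tie_broken_less_iff)
      then have "\<not> kth_smallest kr (map val [0..<r]) \<le> val e"
        using R_le True by auto
      moreover have "kth_smallest kl (map val [r..<p]) \<le> val e"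
        using L_le u u_le by auto
      ultimately show ?thesis by linarith
    qed
    then show ?thesis using True by (simp add: v_def)
  qed
qed

text \<open>Without ties, passing from the entries below \<open>m\<close> to those at most
  \<open>m\<close> adds exactly one entry, so no rank is skipped.\<close>

lemma ex_tie_broken_rank:
  assumes "T < p"
  obtains e where "e < p" "card {i \<in> {..<p}. tie_broken val p i < tie_broken val p e} = T"
proof -
  define m where "m = kth_smallest (Suc T) (map (tie_broken val p) [0..<p])"
  have le: "Suc T \<le> card {i \<in> {..<p}. tie_broken val p i \<le> m}"
    and less: "card {i \<in> {..<p}. tie_broken val p i < m} \<le> T"
    using assms kth_smallest_le_iff[of "[0..<p]" "Suc T" "tie_broken val p" m]
      kth_smallest_less_iff[of "[0..<p]" "Suc T" "tie_broken val p" m]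
    by (simp_all add: atLeast0LessThan flip: m_def)
  have "\<exists>e<p. tie_broken val p e = m"
  proof (rule ccontr)
    assume "\<not> ?thesis"
    then have "{i \<in> {..<p}. tie_broken val p i \<le> m} = {i \<in> {..<p}. tie_broken val p i < m}"
      by (auto simp: order_le_less)
    then show False using le less by simp
  qed
  then obtain e where e: "e < p" "tie_broken val p e = m" by blast
  have "{i \<in> {..<p}. tie_broken val p i \<le> m} = insert e {i \<in> {..<p}. tie_broken val p i < m}"
    using e tie_broken_eq_iff by (auto simp: order_le_less)
  then have "card {i \<in> {..<p}. tie_broken val p i \<le> m} = Suc (card {i \<in> {..<p}. tie_broken val p i < m})"
    using e by simp
  then show ?thesis
    using that[of e] e le less by simp
qed

text \<open>At the copy number \<open>p - 1 - v\<close> of the selected entry, the label condition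
  \<open>p \<le> kr + snd w\<close> reads \<open>v < kr\<close>, which is the criterion of
  \<open>order_statistics_less_iff\<close>.\<close>

lemma order_statistics_less_iff_labelled:
  "kth_smallest kl (map val [r..<p]) < kth_smallest kr (map val [0..<r]) \<longleftrightarrow>
   (\<exists>w \<in> set W. p \<le> kr + snd w \<and> kth_smallest (p * (kl + kr)) (map (copy val p) W) = copy val p w)"
proof -
  have "kl + kr - 1 < p"
    using kl kr r by linarith
  then obtain e where e: "e < p"
    and rank: "card {i \<in> {..<p}. tie_broken val p i < tie_broken val p e} = kl + kr - 1"
    by (rule ex_tie_broken_rank)
  define v where "v = card {i \<in> {..<r}. tie_broken val p i < tie_broken val p e}"
  have "v \<le> kl + kr - 1"
    using rank card_split by (simp add: v_def)
  then have v: "v < p" using \<open>kl + kr - 1 < p\<close> by linarith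
  have "(e, p - 1 - v) \<in> set W"
    using e v by (auto simp: W)
  have pk: "p * (kl + kr) = p * (kl + kr - 1) + p"
    using kl by (cases kl) auto
  have "length W = card (set W)"
    by (rule distinct_card[OF W(1), symmetric])
  \<comment> \<open>The first \<open>p\<close> copies of every entry suffice to make the rank valid,
    since \<open>kl + kr \<le> p\<close>.\<close>
  also have "p * p \<le> \<dots>"
  proof -
    have "{..<p} \<times> {..<p} \<subseteq> set W"
      by (auto simp: W)
    then show ?thesis
      using card_mono[of "set W" "{..<p} \<times> {..<p}"] by simp
  qed
  finally have "p * (kl + kr) \<le> length W"
    using kl kr r by (intro order_trans[OF mult_le_mono2[of "kl + kr" p p]]) linarith+
  moreover have "1 \<le> p * (kl + kr)"
    using e kl by (cases p) auto
  ultimately have less: "kth_smallest (p * (kl + kr)) (map (copy val p) W) < t \<longleftrightarrow>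
      p * (kl + kr) \<le> card {w \<in> set W. copy val p w < t}" for t
    using W by (intro kth_smallest_less_iff)
  \<comment> \<open>Below offset \<open>p - 1 - v\<close> in the block of \<open>e\<close> lie
    \<open>p * (kl + kr - 1) + v + (p - 1 - v)\<close> copies, one fewer than the rank; below the
    next offset lie exactly as many as the rank.\<close>
  have "\<not> kth_smallest (p * (kl + kr)) (map (copy val p) W)
      < int (p + 1) * tie_broken val p e + int (p - 1 - v)"
    unfolding less using v e rank by (subst card_copies_less) (auto simp: pk v_def)
  moreover have "kth_smallest (p * (kl + kr)) (map (copy val p) W)
      < int (p + 1) * tie_broken val p e + int (p - v)"
    unfolding less using v e rank by (subst card_copies_less) (auto simp: pk v_def)
  ultimately have kth:
    "kth_smallest (p * (kl + kr)) (map (copy val p) W) = copy val p (e, p - 1 - v)"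
    using v by (simp add: copy_def of_nat_diff)
  \<comment> \<open>The last digit in base \<open>p + 1\<close> is the copy number, so every copy
    attaining the order statistic has the same label.\<close>
  have "snd w = p - 1 - v" if "w \<in> set W" "copy val p (e, p - 1 - v) = copy val p w" for w
  proof -
    obtain i j where w: "w = (i, j)" by force
    then have "j < p + 1" using that by (auto simp: W split: if_splits)
    moreover have "int (p + 1) * tie_broken val p e + int (p - 1 - v) =
        int (p + 1) * tie_broken val p i + int j"
      using that w by (simp add: copy_def)
    ultimately have "int (p - 1 - v) = int j"
      by (subst (asm) scaled_eq_iff) auto
    then show ?thesis using w by simp
  qed
  then have "(\<exists>w \<in> set W. p \<le> kr + snd w \<and>
      kth_smallest (p * (kl + kr)) (map (copy val p) W) = copy val p w) \<longleftrightarrow>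
      p \<le> kr + (p - 1 - v)"
    unfolding kth using \<open>(e, p - 1 - v) \<in> set W\<close> by force
  also have "\<dots> \<longleftrightarrow> v < kr" using v by linarith
  finally show ?thesis
    using order_statistics_less_iff[OF e rank] by (simp add: v_def)
qed

end

text \<open>The coefficient bound holds for every \<open>B\<close> with the same \<open>Zs\<close>,
  so one construction serves both classes. The factor is \<open>(p + 1) * p\<close> and the shifts
  are at most \<open>(p + 1) * p + p\<close>, both within \<open>(p + 2)\<^sup>2\<close>.\<close>

lemma labelled_rep_if_kstat_rep:
  assumes rep: "kstat_rep n f Ls Rs kl kr"
  defines "p \<equiv> length Ls + length Rs"
  shows "\<exists>Zs k lab. length Zs \<le> 2 * (p + 2)\<^sup>2 \<and> labelled_rep n f Zs k lab \<and>
    (\<forall>B. (\<forall>L \<in> set Ls \<union> set Rs. coeffs_bounded B L) \<longrightarrow>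
         (\<forall>Z \<in> set Zs. coeffs_bounded ((p + 2)\<^sup>2 * (B + 1)) Z))"
proof -
  define r where "r = length Rs"
  define Fs where "Fs = Rs @ Ls"
  define I where "I = (SIGMA i:{..<p}. {..<if i < r then p + 1 else p})"
  have "finite I" by (auto simp: I_def)
  then obtain W where W: "set W = I" "distinct W"
    using finite_distinct_list by blast
  \<comment> \<open>Expanding \<open>(p + 1) * (p * val i + i) + j\<close> turns the two nested
    scalings of \<open>copy\<close> into one.\<close>
  define form where
    "form = (\<lambda>(i, j). scale_shift (int ((p + 1) * p)) (int ((p + 1) * i + j)) (Fs ! i))"
  define Zs where "Zs = map form W"
  \<comment> \<open>The label reads off the copy number only, hence does not depend on the input
    \<open>x\<close>.\<close>
  define lab where "lab q \<longleftrightarrow> p \<le> kr + snd (W ! q)" for q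
  have Fs: "length Fs = p" "set Fs = set Ls \<union> set Rs"
    by (auto simp: Fs_def p_def)
  have lin: "linear_form n L" if "L \<in> set Fs" for L
    using rep that Fs by (simp add: kstat_rep_def)
  have lin_nth: "linear_form n (Fs ! i)" if "i < p" for i
    using lin[of "Fs ! i"] that Fs(1) by simp
  have ks: "1 \<le> kl" "kl \<le> p - r" "1 \<le> kr" "kr \<le> r" "r \<le> p"
    using rep by (auto simp: kstat_rep_def p_def r_def)
  have lenW: "length W = card I"
    using W distinct_card by metis
  have "I \<subseteq> {..<p} \<times> {..<p + 1}"
    by (auto simp: I_def split: if_splits)
  then have "card I \<le> p * (p + 1)"
    using card_mono[of "{..<p} \<times> {..<p + 1}" I] by simp
  then have size: "length Zs \<le> 2 * (p + 2)\<^sup>2"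
    using lenW by (simp add: Zs_def power2_eq_square)
  have "{..<p} \<times> {..<p} \<subseteq> I"
    by (auto simp: I_def)
  then have "p * p \<le> card I"
    using card_mono[of I "{..<p} \<times> {..<p}"] \<open>finite I\<close> by simp
  moreover have "p * (kl + kr) \<le> p * p"
    using ks by (intro mult_le_mono2) linarith
  ultimately have K: "p * (kl + kr) \<le> length Zs"
    unfolding Zs_def length_map lenW by (rule order_trans[rotated])
  have "f x \<longleftrightarrow> (\<exists>q < length Zs. lab q \<and>
      kth_smallest (p * (kl + kr)) (map (\<lambda>L. eval_form L x) Zs) = eval_form (Zs ! q) x)"
    if x: "length x = n" for x
  proof -
    define val where "val i = eval_form (Fs ! i) x" for i
    have eval: "eval_form (form w) x = copy val p w" if "w \<in> set W" for w
    proof -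
      obtain i j where w: "w = (i, j)" by force
      with that W have "i < p" by (simp add: I_def)
      then have "linear_form (length x) (Fs ! i)"
        using lin_nth x by simp
      then show ?thesis
        by (simp add: w form_def copy_def tie_broken_def eval_form_scale_shift val_def algebra_simps)
    qed
    have "map (\<lambda>L. eval_form L x) Rs = map val [0..<r]"
      by (rule nth_equalityI) (auto simp: val_def Fs_def r_def nth_append)
    moreover have "map (\<lambda>L. eval_form L x) Ls = map val [r..<p]"
      by (rule nth_equalityI) (auto simp: val_def Fs_def r_def p_def nth_append)
    ultimately have "f x \<longleftrightarrow>
        kth_smallest kl (map val [r..<p]) < kth_smallest kr (map val [0..<r])"
      using rep x by (simp add: kstat_rep_def)
    also have "\<dots> \<longleftrightarrow> (\<exists>w \<in> set W. p \<le> kr + snd w \<and>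
        kth_smallest (p * (kl + kr)) (map (copy val p) W) = copy val p w)"
      using order_statistics_less_iff_labelled[OF ks(5,1-4) W(2) W(1)[unfolded I_def]] .
    also have "map (copy val p) W = map (\<lambda>L. eval_form L x) Zs"
      using eval by (simp add: Zs_def)
    finally have "f x \<longleftrightarrow> (\<exists>w \<in> set W. p \<le> kr + snd w \<and>
        kth_smallest (p * (kl + kr)) (map (\<lambda>L. eval_form L x) Zs) = eval_form (form w) x)"
      using eval by simp
    also have "\<dots> \<longleftrightarrow> (\<exists>q < length W. p \<le> kr + snd (W ! q) \<and>
        kth_smallest (p * (kl + kr)) (map (\<lambda>L. eval_form L x) Zs) = eval_form (form (W ! q)) x)"
      unfolding Bex_def in_set_conv_nth by blast
    finally show ?thesis
      by (simp add: Zs_def lab_def cong: conj_cong)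
  qed
  moreover have "\<forall>L \<in> set Zs. linear_form n L"
    using lin_nth by (auto simp: Zs_def form_def W I_def)
  moreover have "1 \<le> p * (kl + kr)"
    using ks by (cases p) auto
  ultimately have "labelled_rep n f Zs (p * (kl + kr)) lab"
    using K by (simp add: labelled_rep_def)
  moreover have "coeffs_bounded ((p + 2)\<^sup>2 * (B + 1)) Z"
    if B: "\<forall>L \<in> set Ls \<union> set Rs. coeffs_bounded B L" and "Z \<in> set Zs" for B Z
  proof -
    obtain i j where "(i, j) \<in> I" and Z_form: "Z = form (i, j)"
      using \<open>Z \<in> set Zs\<close> by (auto simp: Zs_def W)
    then have ij: "i < p" "j < p + 1"
      by (auto simp: I_def split: if_splits)
    have Z: "Z = scale_shift (int ((p + 1) * p)) (int ((p + 1) * i + j)) (Fs ! i)"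
      by (simp add: Z_form form_def)
    have "(p + 1) * i + j \<le> (p + 1) * p + p"
      using ij by (intro add_mono mult_le_mono2) auto
    then have "(p + 1) * i + j \<le> (p + 2)\<^sup>2"
      by (simp add: power2_eq_square)
    moreover have "(p + 1) * p \<le> (p + 2)\<^sup>2"
      by (simp add: power2_eq_square)
    moreover have "coeffs_bounded B (Fs ! i)"
      using B Fs ij nth_mem by metis
    ultimately show ?thesis
      unfolding Z by (intro coeffs_bounded_scale_shift) (simp_all only: abs_of_nat of_nat_le_iff)
  qed
  ultimately show ?thesis
    using size by blast
qed

section \<open>From a labelled order statistic to two\<close>

text \<open>The copies of an unlabelled entry are spread out so that the shift of the labelled ones is
  noticed even if there are more unlabelled than labelled entries of value \<open>m\<close>.\<close>

lemma ex_labelled_iff_order_statistics_less: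
  fixes val :: "nat \<Rightarrow> int" and p k :: nat and lab :: "nat \<Rightarrow> bool" and W :: "(nat \<times> nat) list"
  assumes k: "1 \<le> k" "k \<le> p" and W: "distinct W" "set W = {..<p} \<times> {1..p + 1}"
  defines "early \<equiv> \<lambda>(i, j). int (p + 2) * val i + (if lab i then 0 else int j)"
    and "late \<equiv> \<lambda>(i, j). int (p + 2) * val i + (if lab i then int (p + 1) else int j)"
    and "K \<equiv> (p + 1) * (k - 1) + 1" and "m \<equiv> kth_smallest k (map val [0..<p])"
  shows "(\<exists>i<p. lab i \<and> m = val i) \<longleftrightarrow>
    kth_smallest K (map early W) < kth_smallest K (map late W)"
proof -
  define a where "a = card {i \<in> {..<p}. val i < m}"
  define b1 where "b1 = card {i \<in> {..<p}. val i = m \<and> lab i}"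
  define b0 where "b0 = card {i \<in> {..<p}. val i = m \<and> \<not> lab i}"
  have le: "k \<le> card {i \<in> {..<p}. val i \<le> m}" and a: "a < k"
    using k kth_smallest_le_iff[of "[0..<p]" k val m] kth_smallest_less_iff[of "[0..<p]" k val m]
    by (simp_all add: atLeast0LessThan a_def flip: m_def)
  have "{i \<in> {..<p}. val i \<le> m} = {i \<in> {..<p}. val i < m} \<union>
      ({i \<in> {..<p}. val i = m \<and> lab i} \<union> {i \<in> {..<p}. val i = m \<and> \<not> lab i})"
    by auto
  also have "card \<dots> = a + (b1 + b0)"
    unfolding a_def b1_def b0_def by (subst card_Un_disjoint, force, force, force)+ simp
  finally have ab: "k \<le> a + b1 + b0"
    using le by simp
  have "b0 \<le> card {..<p}"
    unfolding b0_def by (intro card_mono) auto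
  then have b0: "b0 \<le> p" by simp
  \<comment> \<open>The choice \<open>d = 0\<close> gives \<open>early\<close> and
    \<open>d = p + 1\<close> gives \<open>late\<close>. A labelled entry of value \<open>m\<close>
    contributes all its copies or none, an unlabelled one those with offsets
    \<open>1, ..., nat h\<close>; \<open>h = -1\<close> leaves only the entries below
    \<open>m\<close>.\<close>
  have count: "card {w \<in> set W. (\<lambda>(i, j). int (p + 2) * val i + (if lab i then int d else int j)) w
        \<le> int (p + 2) * m + h} =
      (p + 1) * a + (if int d \<le> h then (p + 1) * b1 else 0) + nat h * b0"
    if d: "d \<le> p + 1" and h: "-1 \<le> h" "h \<le> int (p + 1)" for d h
  proof -
    have "card {j \<in> {1..p + 1}. int (p + 2) * val i + (if lab i then int d else int j)
        \<le> int (p + 2) * m + h} =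
      (if val i < m then p + 1 else 0) +
      (if val i = m \<and> lab i then (if int d \<le> h then p + 1 else 0) else 0) +
      (if val i = m \<and> \<not> lab i then nat h else 0)" for i
    proof -
      have le: "int (p + 2) * val i + (if lab i then int d else int j) \<le> int (p + 2) * m + h
        \<longleftrightarrow> val i < m \<or> val i = m \<and> (if lab i then int d else int j) \<le> h"
        if "j \<in> {1..p + 1}" for j
      \<comment> \<open>For \<open>h = p + 1\<close> the strict bound \<open>h + 1\<close> is no
        longer a digit in base \<open>p + 2\<close> and carries over to
        \<open>m + 1\<close>.\<close>
      proof (cases "h = int (p + 1)")
        case True
        have "int (p + 2) * val i + (if lab i then int d else int j) < int (p + 2) * (m + 1) + 0
          \<longleftrightarrow> val i \<le> m"
          using that d by (subst scaled_less_iff) auto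
        then show ?thesis
          using True that d by (auto simp: algebra_simps)
      next
        case False
        have "int (p + 2) * val i + (if lab i then int d else int j) < int (p + 2) * m + (h + 1)
          \<longleftrightarrow> val i < m \<or> val i = m \<and> (if lab i then int d else int j) < h + 1"
          using that d h False by (subst scaled_less_iff) auto
        then show ?thesis by auto
      qed
      have "{j \<in> {1..p + 1}. int (p + 2) * val i + (if lab i then int d else int j)
          \<le> int (p + 2) * m + h} =
        {j \<in> {1..p + 1}. val i < m \<or> val i = m \<and> (if lab i then int d else int j) \<le> h}"
        using le by blast
      also have "\<dots> = (if val i < m then {1..p + 1} else if val i = m then
           if lab i then if int d \<le> h then {1..p + 1} else {} else {1..nat h} else {})"
        using h by auto
      finally show ?thesis by simp
    qed
    then show ?thesis
      unfolding W(2) by (subst card_Sigma_filter)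
        (simp_all add: sum.distrib a_def b1_def b0_def flip: sum.inter_filter)
  qed
  have K1: "1 \<le> K" by (simp add: K_def)
  have "(p + 1) * k = (p + 1) * (k - 1) + (p + 1)"
    using k by (cases k) auto
  then have Kk: "K + p = (p + 1) * k"
    by (simp add: K_def)
  have "length W = p * (p + 1)"
    using distinct_card[OF W(1)] W(2) by simp
  then have "(p + 1) * k \<le> length W"
    using mult_le_mono2[OF k(2)] by (simp only: mult.commute[of p])
  then have K2: "K \<le> length W"
    using Kk by linarith
  \<comment> \<open>The copies of entries below \<open>m\<close> do not reach rank \<open>K\<close>,
    while those of entries up to \<open>m\<close> exceed it by at least \<open>p\<close>. This
    places both order statistics in the range of offsets over \<open>m\<close>.\<close>
  have aK: "(p + 1) * a < K"
    using mult_le_mono2[of a "k - 1" "p + 1"] a by (simp only: K_def) linarith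
  have abK: "K + p \<le> (p + 1) * a + (p + 1) * b1 + (p + 1) * b0"
    using mult_le_mono2[OF ab, of "p + 1"] unfolding Kk by (simp add: algebra_simps)
  have early_le: "kth_smallest K (map early W) \<le> int (p + 2) * m + h \<longleftrightarrow>
      K \<le> (p + 1) * a + (if 0 \<le> h then (p + 1) * b1 else 0) + nat h * b0"
    if "-1 \<le> h" "h \<le> int (p + 1)" for h
    unfolding kth_smallest_le_iff[OF W(1) K1 K2] early_def
    using count[of 0 h] that unfolding of_nat_0 by presburger
  have late_le: "kth_smallest K (map late W) \<le> int (p + 2) * m + h \<longleftrightarrow>
      K \<le> (p + 1) * a + (if h = int (p + 1) then (p + 1) * b1 else 0) + nat h * b0"
    if "-1 \<le> h" "h \<le> int (p + 1)" for h
  proof -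
    have "int (p + 1) \<le> h \<longleftrightarrow> h = int (p + 1)"
      using that by linarith
    then show ?thesis
      unfolding kth_smallest_le_iff[OF W(1) K1 K2] late_def
      using count[of "p + 1" h] that by presburger
  qed
  define h where "h = kth_smallest K (map early W) - int (p + 2) * m"
  then have early_eq: "kth_smallest K (map early W) = int (p + 2) * m + h" by simp
  have "\<not> kth_smallest K (map early W) \<le> int (p + 2) * m + (-1)"
    using aK by (subst early_le) auto
  then have h0: "0 \<le> h" using early_eq by linarith
  have "kth_smallest K (map early W) \<le> int (p + 2) * m + int (p + 1)"
  proof -
    have "-1 \<le> int (p + 1)" by simp
    moreover have "K \<le> (p + 1) * a + (p + 1) * b1 + nat (int (p + 1)) * b0"
      using abK unfolding nat_int by linarith
    ultimately show ?thesis
      using early_le[of "int (p + 1)"] by (simp only: of_nat_0_le_iff if_True)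
  qed
  then have hp: "h \<le> int (p + 1)" using early_eq by linarith
  have at_h: "K \<le> (p + 1) * a + (p + 1) * b1 + nat h * b0"
    using early_le[of h] h0 hp early_eq by simp
  have below_h: "(p + 1) * a + (p + 1) * b1 + nat (h - 1) * b0 < K" if "1 \<le> h"
    using early_le[of "h - 1"] that hp early_eq by simp
  show ?thesis
  proof (cases "\<exists>i<p. lab i \<and> m = val i")
    case False
    \<comment> \<open>Without labelled copies of value \<open>m\<close> the two counts
      coincide.\<close>
    then have "b1 = 0"
      by (auto simp: b1_def)
    then have "kth_smallest K (map late W) \<le> int (p + 2) * m + h"
      using late_le[of h] h0 hp at_h by auto
    then show ?thesis using False early_eq by simp
  next
    case True
    then have "{i \<in> {..<p}. val i = m \<and> lab i} \<noteq> {}" by auto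
    then have "0 < b1"
      unfolding b1_def by (subst card_gt_0_iff) simp
    then have b1: "p + 1 \<le> (p + 1) * b1"
      by (cases b1) auto
    \<comment> \<open>At offset \<open>h\<close> the late list lacks the \<open>(p + 1) * b1\<close>
      labelled copies. For \<open>1 \<le> h\<close>, raising the offset from \<open>h - 1\<close> to
      \<open>h\<close> adds only \<open>b0 \<le> p\<close> copies, which cannot make up for
      them.\<close>
    have "(p + 1) * a + (if h = int (p + 1) then (p + 1) * b1 else 0) + nat h * b0 < K"
    proof (cases "1 \<le> h")
      case False
      then show ?thesis using h0 aK by simp
    next
      case h1: True
      have step: "nat h * b0 = nat (h - 1) * b0 + b0"
        using h1 by (cases "nat h") (auto simp: nat_diff_distrib)
      \<comment> \<open>Otherwise the count at \<open>h - 1\<close> would fall short of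
        \<open>K\<close>, although it omits only \<open>b0 \<le> p\<close> copies from a total of at
        least \<open>K + p\<close>.\<close>
      have "h \<noteq> int (p + 1)"
      proof
        assume "h = int (p + 1)"
        then show False
          using below_h[OF h1] step abK b0 by (simp add: algebra_simps)
      qed
      then show ?thesis
        using below_h[OF h1] step b0 b1 by simp
    qed
    then have "\<not> kth_smallest K (map late W) \<le> int (p + 2) * m + h"
      using late_le[of h] h0 hp by simp
    then show ?thesis using True early_eq by simp
  qed
qed

text \<open>Both lists use the rank \<open>K\<close> and have \<open>p * (p + 1)\<close> forms. They
  differ only in the shift \<open>d\<close> of the copies of labelled forms: \<open>0\<close> on the
  left, \<open>p + 1\<close> on the right.\<close>

lemma kstat_rep_if_labelled_rep:
  assumes rep: "labelled_rep n f Zs k lab"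
  defines "p \<equiv> length Zs"
  shows "\<exists>Ls Rs kl kr. length Ls + length Rs \<le> 2 * (p + 2)\<^sup>2 \<and> kstat_rep n f Ls Rs kl kr \<and>
    (\<forall>B. (\<forall>Z \<in> set Zs. coeffs_bounded B Z) \<longrightarrow>
         (\<forall>L \<in> set Ls \<union> set Rs. coeffs_bounded ((p + 2)\<^sup>2 * (B + 1)) L))"
proof -
  obtain W where W: "set W = {..<p} \<times> {1..p + 1}" "distinct W"
    using finite_distinct_list[of "{..<p} \<times> {1..p + 1}"] by auto
  define K where "K = (p + 1) * (k - 1) + 1"
  define form where
    "form d = (\<lambda>(i, j). scale_shift (int (p + 2)) (int (if lab i then d else j)) (Zs ! i))" for d
  have k: "1 \<le> k" "k \<le> p" and lin: "\<And>Z. Z \<in> set Zs \<Longrightarrow> linear_form n Z"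
    using rep by (auto simp: labelled_rep_def p_def)
  have lenW: "length W = p * (p + 1)"
    using distinct_card[OF W(2)] W(1) by simp
  have "(p + 1) * (k - 1) + (p + 1) = (p + 1) * k"
    using k by (cases k) auto
  also have "\<dots> \<le> length W"
    unfolding lenW mult.commute[of p] using k(2) by (rule mult_le_mono2)
  finally have K: "1 \<le> K" "K \<le> length W"
    by (simp_all add: K_def)
  have "f x \<longleftrightarrow> kth_smallest K (map (\<lambda>L. eval_form L x) (map (form 0) W)) <
      kth_smallest K (map (\<lambda>L. eval_form L x) (map (form (p + 1)) W))"
    if x: "length x = n" for x
  proof -
    define val where "val i = eval_form (Zs ! i) x" for i
    have eval: "map (\<lambda>L. eval_form L x) (map (form d) W) =
        map (\<lambda>(i, j). int (p + 2) * val i + (if lab i then int d else int j)) W" for d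
      using x lin W by (auto simp: form_def eval_form_scale_shift val_def p_def)
    have "f x \<longleftrightarrow> (\<exists>i<p. lab i \<and> kth_smallest k (map val [0..<p]) = val i)"
    proof -
      have "map (\<lambda>L. eval_form L x) Zs = map val [0..<p]"
        by (rule nth_equalityI) (auto simp: p_def val_def)
      then show ?thesis
        using rep x by (simp add: labelled_rep_def p_def val_def)
    qed
    then show ?thesis
      unfolding eval K_def of_nat_0
      using ex_labelled_iff_order_statistics_less[OF k W(2,1)] by simp
  qed
  moreover have "linear_form n L" if L: "L \<in> set (map (form d) W)" for L d
  proof -
    obtain i j where "i < p" "L = form d (i, j)"
      using L W by auto
    then show ?thesis
      using lin by (simp add: form_def p_def)
  qed
  ultimately have "kstat_rep n f (map (form 0) W) (map (form (p + 1)) W) K K"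
    using K unfolding kstat_rep_def length_map by blast
  moreover have "length (map (form 0) W) + length (map (form (p + 1)) W) \<le> 2 * (p + 2)\<^sup>2"
    using lenW by (simp add: power2_eq_square)
  moreover have "coeffs_bounded ((p + 2)\<^sup>2 * (B + 1)) L"
    if B: "\<forall>Z \<in> set Zs. coeffs_bounded B Z" and d: "d \<le> p + 1" and L: "L \<in> set (map (form d) W)"
    for B L d
  proof -
    obtain i j where ij: "i < p" "j \<le> p + 1" and
      L: "L = scale_shift (int (p + 2)) (int (if lab i then d else j)) (Zs ! i)"
      using L by (auto simp: form_def W)
    have "p + 2 \<le> (p + 2)\<^sup>2"
      by (simp add: power2_eq_square)
    moreover from this have "(if lab i then d else j) \<le> (p + 2)\<^sup>2"
      using ij d by (simp split: if_splits)
    moreover have "coeffs_bounded B (Zs ! i)"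
      using B ij by (simp add: p_def)
    ultimately show ?thesis
      unfolding L by (intro coeffs_bounded_scale_shift) (simp_all only: abs_of_nat of_nat_le_iff)
  qed
  ultimately show ?thesis
    by (metis Un_iff le0 order_refl)
qed

section \<open>Polynomial bounds and the two characterizations\<close>

lemma size_bound_poly:
  fixes s :: "nat poly"
  assumes "p \<le> poly s n" "q \<le> 2 * (p + 2)\<^sup>2"
  shows "q \<le> poly (2 * (s + 2)\<^sup>2) n"
proof -
  have "2 * (p + 2)\<^sup>2 \<le> 2 * (poly s n + 2)\<^sup>2"
    using assms by (intro mult_le_mono power_mono) auto
  also have "\<dots> = poly (2 * (s + 2)\<^sup>2) n"
    by simp
  finally show ?thesis
    by (rule order_trans[OF assms(2)])
qed

lemma coeffs_bounded_poly:
  fixes s t :: "nat poly"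
  assumes "p \<le> poly s n" "coeffs_bounded ((p + 2)\<^sup>2 * (poly t n + 1)) L"
  shows "coeffs_bounded (poly ((s + 2)\<^sup>2 * (t + 1)) n) L"
proof -
  have "(p + 2)\<^sup>2 * (poly t n + 1) \<le> (poly s n + 2)\<^sup>2 * (poly t n + 1)"
    using assms by (intro mult_le_mono power_mono) auto
  also have "\<dots> = poly ((s + 2)\<^sup>2 * (t + 1)) n"
    by simp
  finally show ?thesis
    by (rule coeffs_bounded_mono[OF assms(2)])
qed

text \<open>The constructions are applied for each \<open>n\<close> separately; their bounds depend
  only on the size and the coefficient bound, so substituting \<open>s\<close> and \<open>t\<close>
  gives polynomials uniform in \<open>n\<close>.\<close>

theorem theorem5:
  "kSTAT = {f. \<exists>s :: nat poly. \<forall>n. \<exists>Ls k lab.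
      length Ls \<le> poly s n \<and> labelled_rep n f Ls k lab} \<and>
   kSTAT_poly = {f. \<exists>s t :: nat poly. \<forall>n. \<exists>Ls k lab.
      length Ls \<le> poly s n \<and> labelled_rep n f Ls k lab \<and>
      (\<forall>L \<in> set Ls. coeffs_bounded (poly t n) L)}"
proof (intro conjI set_eqI iffI)
  fix f assume "f \<in> kSTAT"
  then obtain s :: "nat poly" where s: "\<And>n. \<exists>Ls Rs kl kr.
      length Ls + length Rs \<le> poly s n \<and> kstat_rep n f Ls Rs kl kr"
    unfolding kSTAT_def by blast
  have "\<exists>Zs k lab. length Zs \<le> poly (2 * (s + 2)\<^sup>2) n \<and> labelled_rep n f Zs k lab" for n
  proof -
    obtain Ls Rs kl kr where *: "length Ls + length Rs \<le> poly s n" "kstat_rep n f Ls Rs kl kr"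
      using s by blast
    show ?thesis
      using labelled_rep_if_kstat_rep[OF *(2)] size_bound_poly[OF *(1)] by blast
  qed
  then show "f \<in> {f. \<exists>s :: nat poly. \<forall>n. \<exists>Ls k lab.
      length Ls \<le> poly s n \<and> labelled_rep n f Ls k lab}" by blast
next
  fix f assume "f \<in> {f. \<exists>s :: nat poly. \<forall>n. \<exists>Ls k lab.
      length Ls \<le> poly s n \<and> labelled_rep n f Ls k lab}"
  then obtain s :: "nat poly" where s: "\<And>n. \<exists>Zs k lab.
      length Zs \<le> poly s n \<and> labelled_rep n f Zs k lab"
    by blast
  have "\<exists>Ls Rs kl kr. length Ls + length Rs \<le> poly (2 * (s + 2)\<^sup>2) n \<and>
      kstat_rep n f Ls Rs kl kr" for n
  proof -
    obtain Zs k lab where *: "length Zs \<le> poly s n" "labelled_rep n f Zs k lab"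
      using s by blast
    show ?thesis
      using kstat_rep_if_labelled_rep[OF *(2)] size_bound_poly[OF *(1)] by blast
  qed
  then show "f \<in> kSTAT" unfolding kSTAT_def by blast
next
  fix f assume "f \<in> kSTAT_poly"
  then obtain s t :: "nat poly" where s: "\<And>n. \<exists>Ls Rs kl kr.
      length Ls + length Rs \<le> poly s n \<and> kstat_rep n f Ls Rs kl kr \<and>
      (\<forall>L \<in> set Ls \<union> set Rs. coeffs_bounded (poly t n) L)"
    unfolding kSTAT_poly_def by blast
  have "\<exists>Zs k lab. length Zs \<le> poly (2 * (s + 2)\<^sup>2) n \<and> labelled_rep n f Zs k lab \<and>
      (\<forall>Z \<in> set Zs. coeffs_bounded (poly ((s + 2)\<^sup>2 * (t + 1)) n) Z)" for n
  proof -
    obtain Ls Rs kl kr where *: "length Ls + length Rs \<le> poly s n" "kstat_rep n f Ls Rs kl kr"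
        "\<forall>L \<in> set Ls \<union> set Rs. coeffs_bounded (poly t n) L"
      using s by blast
    then obtain Zs k lab where "length Zs \<le> 2 * (length Ls + length Rs + 2)\<^sup>2"
        "labelled_rep n f Zs k lab"
        "\<forall>Z \<in> set Zs. coeffs_bounded ((length Ls + length Rs + 2)\<^sup>2 * (poly t n + 1)) Z"
      using labelled_rep_if_kstat_rep[OF *(2)] by blast
    then show ?thesis
      using size_bound_poly[OF *(1)] coeffs_bounded_poly[OF *(1)] by blast
  qed
  then show "f \<in> {f. \<exists>s t :: nat poly. \<forall>n. \<exists>Ls k lab.
      length Ls \<le> poly s n \<and> labelled_rep n f Ls k lab \<and>
      (\<forall>L \<in> set Ls. coeffs_bounded (poly t n) L)}" by blast
next
  fix f assume "f \<in> {f. \<exists>s t :: nat poly. \<forall>n. \<exists>Ls k lab.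
      length Ls \<le> poly s n \<and> labelled_rep n f Ls k lab \<and>
      (\<forall>L \<in> set Ls. coeffs_bounded (poly t n) L)}"
  then obtain s t :: "nat poly" where s: "\<And>n. \<exists>Zs k lab.
      length Zs \<le> poly s n \<and> labelled_rep n f Zs k lab \<and>
      (\<forall>Z \<in> set Zs. coeffs_bounded (poly t n) Z)"
    by blast
  have "\<exists>Ls Rs kl kr. length Ls + length Rs \<le> poly (2 * (s + 2)\<^sup>2) n \<and>
      kstat_rep n f Ls Rs kl kr \<and>
      (\<forall>L \<in> set Ls \<union> set Rs. coeffs_bounded (poly ((s + 2)\<^sup>2 * (t + 1)) n) L)" for n
  proof -
    obtain Zs k lab where *: "length Zs \<le> poly s n" "labelled_rep n f Zs k lab"
        "\<forall>Z \<in> set Zs. coeffs_bounded (poly t n) Z"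
      using s by blast
    then obtain Ls Rs kl kr where "length Ls + length Rs \<le> 2 * (length Zs + 2)\<^sup>2"
        "kstat_rep n f Ls Rs kl kr"
        "\<forall>L \<in> set Ls \<union> set Rs. coeffs_bounded ((length Zs + 2)\<^sup>2 * (poly t n + 1)) L"
      using kstat_rep_if_labelled_rep[OF *(2)] by blast
    then show ?thesis
      using size_bound_poly[OF *(1)] coeffs_bounded_poly[OF *(1)] by blast
  qed
  then show "f \<in> kSTAT_poly" unfolding kSTAT_poly_def by blast
qed

end
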